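(* Let $\Lambda_6$ be the lattice with basis $e_1,\dots,e_6$ and Gram matrix $2\begin{pmatrix}2&-1&0&0&0&0\\-1&2&-1&0&0&0\\0&-1&2&-1&0&-1\\0&0&-1&2&-1&0\\0&0&0&-1&2&0\\0&0&-1&0&0&2\end{pmatrix}$. Every integral lattice $M$ in $\mathbb{R}\Lambda_6$ with $\Lambda_6\subseteq M$ is isometric to one of the six lattices $\Lambda_6$, $\Lambda_6(\tfrac12 e_1)$, $\Lambda_6(\tfrac12(e_1+e_3))$, $\Lambda_6(\tfrac12 e_1,\tfrac12 e_3)$, $\Lambda_6(\tfrac12(e_1+e_3),\tfrac12(e_1+e_5))$, $\Lambda_6(\tfrac12 e_1,\tfrac12 e_3,\tfrac12 e_5)$.
   Context: A lattice is integral if all inner products of its vectors are integers. For a lattice $L$ and vectors $x_1,\dots,x_k$ in $\mathbb{R}L$, $L(x_1,\dots,x_k)$ denotes the lattice generated by $L$ and the $x_i$. *)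

theory Defs
  imports "HOL-Analysis.Analysis"
begin

(* A real vector space regarded as a module over the integers. *)
global_interpretation int_mod: module "\<lambda>(k::int) (x::'a::real_vector). of_int k *\<^sub>R x"
  defines int_span = int_mod.span
  by unfold_locales (simp_all add: algebra_simps)

definition lattice_basis :: "'a::euclidean_space list \<Rightarrow> 'a set \<Rightarrow> bool" where
  "lattice_basis bs L \<longleftrightarrow> distinct bs \<and> independent (set bs) \<and> L = int_span (set bs)"

(* The basis need not span the ambient space; the real space of L is span L. *)
definition is_lattice :: "'a::euclidean_space set \<Rightarrow> bool" where
  "is_lattice L \<longleftrightarrow> (\<exists>bs. lattice_basis bs L)"

definition gram_matrix :: "'a::real_inner list \<Rightarrow> real list list" where
  "gram_matrix bs = map (\<lambda>x. map (\<lambda>y. x \<bullet> y) bs) bs"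

definition integral_lattice :: "'a::euclidean_space set \<Rightarrow> bool" where
  "integral_lattice L \<longleftrightarrow> is_lattice L \<and> (\<forall>x\<in>L. \<forall>y\<in>L. x \<bullet> y \<in> \<int>)"

definition adjoin :: "'a::euclidean_space set \<Rightarrow> 'a set \<Rightarrow> 'a set" where
  "adjoin L X = int_span (L \<union> X)"

(* Only the restriction of f to span L matters: it is a linear isometry from
   span L onto span M. *)
definition isometric :: "'a::euclidean_space set \<Rightarrow> 'b::euclidean_space set \<Rightarrow> bool" where
  "isometric L M \<longleftrightarrow>
    (\<exists>f. linear f \<and> (\<forall>x\<in>span L. \<forall>y\<in>span L. f x \<bullet> f y = x \<bullet> y) \<and> f ` L = M)"

end

(* In a scaled copy of E6 (all norms doubled), an integral overlattice M lies between Lambda_6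
   and (1/2) Lambda_6: the 3-part of the discriminant group Z/3 is anisotropic. Hence M is given by
   a totally isotropic subspace S of the symplectic space E6/2E6 over F_2, and the quadratic form
   q(v) = (v, v)/2 mod 2 is linear on S. The roots of E6 represent all classes with q = 1, so
   the Weyl group acts through all transvections of q, and a Witt-type argument moves S to a standard
   subspace determined by dim S and by whether q vanishes on S. The finitely many facts
   needed about the 64 classes are checked by rewriting. *)

theory Submission
  imports Defs
begin

text \<open>Keeps the simplifier from splitting quantifiers over \<open>vec\<close> into six integer
  quantifiers.\<close>

declare split_paired_All [simp del] split_paired_Ex [simp del]

section \<open>The E6 form and its reflections in coordinates\<close>

(* Coordinates of elements of E6 with respect to the simple roots. *)
type_synonym vec = "int \<times> int \<times> int \<times> int \<times> int \<times> int"

(* Half the E6 norm, so that roots have value 1. *)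
fun qf :: "vec \<Rightarrow> int" where
  "qf (a, b, c, d, e, f) =
    a * a + b * b + c * c + d * d + e * e + f * f - a * b - b * c - c * d - d * e - c * f"

text \<open>The polar form of \<open>qf\<close>, that is, the E6 inner product itself; Lambda_6
  carries twice this form.\<close>

definition bf :: "vec \<Rightarrow> vec \<Rightarrow> int" where
  "bf u v = qf (u + v) - qf u - qf v"

fun scale :: "int \<Rightarrow> vec \<Rightarrow> vec" where
  "scale k (a, b, c, d, e, f) = (k * a, k * b, k * c, k * d, k * e, k * f)"

text \<open>For a root \<open>r\<close>, where \<open>bf r r = 2\<close>, this is the orthogonal
  reflection in \<open>r\<close>.\<close>

definition reflect :: "vec \<Rightarrow> vec \<Rightarrow> vec" where
  "reflect r v = v - scale (bf v r) r"

fun par :: "vec \<Rightarrow> vec" where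
  "par (a, b, c, d, e, f) = (a mod 2, b mod 2, c mod 2, d mod 2, e mod 2, f mod 2)"

lemma bf_commute: "bf u v = bf v u"
  by (simp add: bf_def add.commute)

lemma bf_add_left: "bf (u + v) w = bf u w + bf v w"
  by (cases u; cases v; cases w) (simp add: bf_def algebra_simps)

lemma bf_add_right: "bf w (u + v) = bf w u + bf w v"
  by (simp add: bf_add_left bf_commute[of w])

lemma bf_self: "bf v v = 2 * qf v"
  by (cases v) (simp add: bf_def algebra_simps)

lemma bf_scale_left: "bf (scale k u) v = k * bf u v"
  by (cases u; cases v) (simp add: bf_def algebra_simps)

lemma bf_diff_left: "bf (u - v) w = bf u w - bf v w"
  using bf_add_left[of "u - v" v w] by simp

lemma qf_add: "qf (u + v) = qf u + qf v + bf u v"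
  by (simp add: bf_def)

lemma qf_diff: "qf (u - v) = qf u + qf v - bf u v"
  using qf_add[of "u - v" v] by (simp add: bf_diff_left bf_self)

lemma qf_scale: "qf (scale k u) = k * k * qf u"
  by (cases u) (simp add: algebra_simps)

lemma scale_add_left: "scale (j + k) v = scale j v + scale k v"
  by (cases v) (simp add: algebra_simps)

lemma scale_minus_left: "scale (- k) v = - scale k v"
  by (cases v) simp

lemma reflect_add: "reflect r (u + v) = reflect r u + reflect r v"
  by (simp add: reflect_def bf_add_left scale_add_left)

lemma qf_reflect:
  assumes "qf r = 1"
  shows "qf (reflect r v) = qf v"
  by (simp add: reflect_def qf_diff qf_scale assms bf_commute[of v "scale _ r"] bf_scale_left
      bf_commute[of r v])

lemma bf_reflect:
  assumes "qf r = 1"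
  shows "bf (reflect r u) (reflect r v) = bf u v"
  by (simp add: bf_def qf_reflect[OF assms] flip: reflect_add)

lemma reflect_reflect:
  assumes "qf r = 1"
  shows "reflect r (reflect r v) = v"
proof -
  have "bf (reflect r v) r = - bf v r"
    using assms by (simp add: reflect_def bf_diff_left bf_scale_left bf_self)
  then show ?thesis
    by (simp add: reflect_def[of r "reflect r v"] scale_minus_left) (simp add: reflect_def)
qed

section \<open>Reduction modulo 2 and the 64 classes of E6/2E6\<close>

text \<open>Writing the difference as \<open>y + y\<close> lets the additivity lemmas for
  \<open>bf\<close> and \<open>qf\<close> carry out all later computations modulo 2.\<close>

lemma par_eq_iff: "par u = par v \<longleftrightarrow> (\<exists>y. u = v + (y + y))"
proof
  assume "par u = par v"
  then show "\<exists>y. u = v + (y + y)"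
  proof (cases u; cases v)
    fix a b c d e f a' b' c' d' e' f'
    assume u: "u = (a, b, c, d, e, f)" and v: "v = (a', b', c', d', e', f')"
    have half: "x = x' + 2 * ((x - x') div 2)" if "x mod 2 = x' mod 2" for x x' :: int
      using that by presburger
    show ?thesis
      using \<open>par u = par v\<close> unfolding u v
      by (intro exI[of _ "((a - a') div 2, (b - b') div 2, (c - c') div 2,
            (d - d') div 2, (e - e') div 2, (f - f') div 2)"]) (auto intro!: half)
  qed
next
  assume "\<exists>y. u = v + (y + y)"
  then show "par u = par v"
    by (cases v) auto
qed

lemma par_add_cong: "par u = par u' \<Longrightarrow> par v = par v' \<Longrightarrow> par (u + v) = par (u' + v')"
  unfolding par_eq_iff
proof (elim exE)
  fix x y assume "u = u' + (x + x)" "v = v' + (y + y)"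
  then show "\<exists>z. u + v = u' + v' + (z + z)"
    by (intro exI[of _ "x + y"]) (simp add: algebra_simps)
qed

lemma even_bf_cong: "par u = par u' \<Longrightarrow> par v = par v' \<Longrightarrow> even (bf u v) = even (bf u' v')"
  unfolding par_eq_iff by (elim exE) (simp add: bf_add_left bf_add_right)

text \<open>Adding \<open>y + y\<close> to \<open>u'\<close> changes \<open>qf\<close> by
  \<open>4 * qf y + 2 * bf u' y\<close>, so \<open>qf\<close> modulo 2 descends to E6/2E6.\<close>

lemma even_qf_cong: "par u = par u' \<Longrightarrow> even (qf u) = even (qf u')"
  unfolding par_eq_iff by (elim exE) (simp add: qf_add bf_add_left bf_add_right bf_self)

lemma par_par [simp]: "par (par v) = par v"
  by (cases v) simp

definition bits :: "vec list" where
  "bits = List.product [0, 1] (List.product [0, 1] (List.product [0, 1]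
    (List.product [0, 1] (List.product [0, 1] [0, 1]))))"

lemma par_in_bits: "par v \<in> set bits"
proof -
  have "x mod 2 \<in> set [0, 1]" for x :: int
    by auto
  then show ?thesis
    by (cases v) (simp only: bits_def set_product mem_Times_iff par.simps fst_conv snd_conv simp_thms)
qed

(* The positive roots having a coefficient at least 2. The other 25 are already vectors of bits. *)
definition high_roots :: "vec list" where
  "high_roots = [(0, 1, 2, 1, 0, 1), (0, 1, 2, 1, 1, 1), (0, 1, 2, 2, 1, 1), (1, 1, 2, 1, 0, 1), (1, 1, 2, 1, 1, 1), (1, 1, 2, 2, 1, 1), (1, 2, 2, 1, 0, 1), (1, 2, 2, 1, 1, 1), (1, 2, 2, 2, 1, 1), (1, 2, 3, 2, 1, 1), (1, 2, 3, 2, 1, 2)]"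

text \<open>E6 has 36 pairs of opposite roots, one for each of the 36 odd classes. The 0-1
  representative of such a class is a root itself or the reduction of a high root.\<close>

lemma exists_root_table:
  "\<forall>v \<in> set bits. odd (qf v) \<longrightarrow> (\<exists>r \<in> set (v # high_roots). qf r = 1 \<and> par r = v)"
  by code_simp

lemma exists_root:
  assumes "odd (qf v)"
  obtains r where "qf r = 1" "par r = par v"
proof -
  have "odd (qf (par v))"
    using assms even_qf_cong[of "par v" v] by simp
  then have "\<exists>r \<in> set (par v # high_roots). qf r = 1 \<and> par r = par v"
    using bspec[OF exists_root_table par_in_bits] by (rule mp[rotated])
  then show ?thesis
    using that by (elim bexE conjE)
qed

section \<open>Totally isotropic subspaces and the action of root reflections on them\<close>

(* S stands for a totally isotropic subspace of E6/2E6; it is represented by its full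
   preimage in E6, whence the condition that it contains all v + v. *)
definition isotropic :: "vec set \<Rightarrow> bool" where
  "isotropic S \<longleftrightarrow> (\<forall>u\<in>S. \<forall>v\<in>S. u + v \<in> S \<and> even (bf u v)) \<and> (\<forall>v. v + v \<in> S)"

lemma isotropic_par_cong:
  assumes "isotropic S" "par u = par v"
  shows "u \<in> S \<longleftrightarrow> v \<in> S"
  using assms by (metis isotropic_def par_eq_iff)

text \<open>All doubles lie in \<open>S\<close>, so only the parity of \<open>k\<close> matters; in
  particular this supplies negatives.\<close>

lemma isotropic_scale:
  assumes "isotropic S" "v \<in> S"
  shows "scale k v \<in> S"
proof (cases "even k")
  case True
  then obtain j where "k = j + j"
    by (metis evenE mult_2)
  then have "scale k v = scale j v + scale j v"
    by (simp only: scale_add_left)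
  then show ?thesis
    using assms by (simp add: isotropic_def)
next
  case False
  then obtain j where "k = 1 + (j + j)"
    by (metis add.commute mult_2 oddE)
  then have "scale k v = v + (scale j v + scale j v)"
    by (cases v) (simp add: algebra_simps)
  then show ?thesis
    using assms by (simp add: isotropic_def)
qed

lemma isotropic_vimage_reflect:
  assumes "isotropic S" "qf r = 1"
  shows "isotropic (reflect r -` S)"
  using assms(1) bf_reflect[OF assms(2)] unfolding isotropic_def vimage_def
  by (simp add: reflect_add) metis

text \<open>The preimage equals the image, a reflection being an involution, and makes membership a
  matter of rewriting.\<close>

definition move :: "vec set \<Rightarrow> vec set \<Rightarrow> bool" where
  "move S T \<longleftrightarrow> (\<exists>r. qf r = 1 \<and> T = reflect r -` S)"

lemma isotropic_moves:
  assumes "move\<^sup>*\<^sup>* S T" "isotropic S"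
  shows "isotropic T"
  using assms by (induction rule: rtranclp_induct) (auto simp: move_def isotropic_vimage_reflect)

lemma even_moves:
  assumes "move\<^sup>*\<^sup>* S T" "\<forall>v\<in>S. even (qf v)"
  shows "\<forall>v\<in>T. even (qf v)"
  using assms
proof (induction rule: rtranclp_induct)
  case (step T U)
  obtain r where r: "qf r = 1" "U = reflect r -` T"
    using step(2) unfolding move_def by blast
  have "even (qf (reflect r v))" if "v \<in> U" for v
    using step(3,4) that r(2) by blast
  then show ?case
    by (simp add: qf_reflect[OF r(1)])
qed

text \<open>Modulo 2 the reflection in \<open>r\<close> is a transvection: here a double is
  subtracted, and in the odd case below the class of \<open>r\<close> is added.\<close>

lemma par_reflect_even:
  assumes "even (bf v r)"
  shows "par (reflect r v) = par v"
proof -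
  obtain k where k: "bf v r = k + k"
    using assms by (metis evenE mult_2)
  have "reflect r v = v + (scale (- k) r + scale (- k) r)"
    by (simp only: reflect_def k scale_add_left scale_minus_left) (simp add: algebra_simps)
  then show ?thesis
    unfolding par_eq_iff by blast
qed

lemma par_reflect_odd:
  assumes "odd (bf v r)"
  shows "par (reflect r v) = par (v + r)"
proof -
  \<comment> \<open>The offset is \<open>- 1\<close> because \<open>reflect\<close> subtracts the
    multiple of \<open>r\<close>; up to a double this leaves \<open>v + r\<close>.\<close>
  obtain k where k: "bf v r = - 1 + (k + k)"
    by (rule that[of "(bf v r + 1) div 2"]) (use assms in presburger)
  have "scale 1 r = r"
    by (cases r) simp
  then have "reflect r v = (v + r) + (scale (- k) r + scale (- k) r)"
    by (simp only: reflect_def k scale_add_left scale_minus_left) (simp add: algebra_simps)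
  then show ?thesis
    unfolding par_eq_iff by blast
qed

(* If u and v pair oddly and agree under q, the class u + v is that of a root, and its
   reflection interchanges u and v modulo 2. *)
lemma move_one:
  assumes S: "isotropic S" "v \<in> S" and FS: "F \<subseteq> S"
    and F: "\<And>f. f \<in> F \<Longrightarrow> even (bf f u)" "\<And>f. f \<in> F \<Longrightarrow> even (bf f v)"
    and uv: "odd (bf u v)" "even (qf u - qf v)"
  obtains T where "move S T" "insert u F \<subseteq> T"
proof -
  have "odd (qf (u + v))"
    using uv by (auto simp: qf_add)
  then obtain r where r: "qf r = 1" "par r = par (u + v)"
    using exists_root by blast
  have "odd (bf u r)"
    using uv(1) even_bf_cong[OF refl r(2), of u] by (simp add: bf_add_right bf_self)
  then have "par (reflect r u) = par (u + r)"
    by (rule par_reflect_odd)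
  also have "\<dots> = par (u + (u + v))"
    using r by (intro par_add_cong) auto
  also have "\<dots> = par v"
    unfolding par_eq_iff by (intro exI[of _ u]) simp
  finally have u: "u \<in> reflect r -` S"
    using S isotropic_par_cong by blast
  \<comment> \<open>Each \<open>f\<close> pairs evenly with \<open>u\<close> and \<open>v\<close>,
    hence with \<open>r\<close>, so the reflection fixes its class.\<close>
  have "f \<in> reflect r -` S" if "f \<in> F" for f
  proof -
    have "even (bf f r)"
      using F that even_bf_cong[OF refl r(2), of f] by (simp add: bf_add_right)
    then show ?thesis
      using par_reflect_even isotropic_par_cong[OF S(1)] that FS by blast
  qed
  with u r show ?thesis
    by (intro that[of "reflect r -` S"]) (auto simp: move_def)
qed

section \<open>Witt-type extension of a partial standard basis\<close>

fun subset_sums :: "vec list \<Rightarrow> vec list" where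
  "subset_sums [] = [0]"
| "subset_sums (f # F) = subset_sums F @ map ((+) f) (subset_sums F)"

lemma subset_sums_in_isotropic:
  assumes "isotropic S" "set F \<subseteq> S"
  shows "set (subset_sums F) \<subseteq> S"
  using assms(2)
proof (induction F)
  case Nil
  have "0 + 0 \<in> S"
    using assms(1) unfolding isotropic_def by blast
  then show ?case by simp
next
  case (Cons f F)
  then show ?case
    using assms(1) by (auto simp: isotropic_def)
qed

text \<open>The full preimage in E6 of the F_2-span of \<open>F\<close>.\<close>

definition hull2 :: "vec list \<Rightarrow> vec set" where
  "hull2 F = {v. par v \<in> par ` set (subset_sums F)}"

(* One reflection moves z to u if they pair oddly; otherwise two do, via some w. *)
definition reachable :: "vec list \<Rightarrow> vec \<Rightarrow> vec \<Rightarrow> bool" where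
  "reachable F u z \<longleftrightarrow> even (qf u - qf z) \<and>
    (par z = par u \<or> odd (bf u z) \<or>
      (\<exists>w\<in>set bits. odd (bf u w) \<and> odd (bf w z) \<and> even (qf u - qf w) \<and> (\<forall>f\<in>set F. even (bf f w))))"

text \<open>A decidable criterion for enlarging \<open>F\<close> by \<open>u\<close>, with
  \<open>A\<close> restricting the classes considered. The correction \<open>x\<close> from the span
  of \<open>F\<close> lets the parity of \<open>qf\<close> be adjusted when \<open>F\<close>
  contains an odd vector.\<close>

definition extensible :: "(vec \<Rightarrow> bool) \<Rightarrow> vec list \<Rightarrow> vec \<Rightarrow> bool" where
  "extensible A F u \<longleftrightarrow> (\<forall>f\<in>set F. even (bf f u)) \<and>
    (\<forall>v\<in>set bits. A v \<and> (\<forall>f\<in>set F. even (bf f v)) \<longrightarrow>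
      v \<in> par ` set (subset_sums F) \<or> (\<exists>x\<in>set (subset_sums F). reachable F u (v + x)))"

text \<open>Since \<open>F\<close> lies in \<open>S\<close>, the shift by \<open>x\<close> does not
  leave \<open>S\<close>; at most two reflections, each fixing the classes of \<open>F\<close>, then
  bring in \<open>u\<close>.\<close>

lemma extend:
  assumes S: "isotropic S" "set F \<subseteq> S" and ext: "extensible A F u"
    and v: "v \<in> S" "A (par v)" "v \<notin> hull2 F"
  obtains T where "move\<^sup>*\<^sup>* S T" "set (u # F) \<subseteq> T"
proof -
  have pv: "par v \<in> S"
    using v(1) isotropic_par_cong[OF S(1), of "par v" v] by simp
  have Fu: "even (bf f u)" if "f \<in> set F" for f
    using ext that by (auto simp: extensible_def)
  have orth: "even (bf f z)" if "f \<in> set F" "z \<in> S" for f z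
    using S that by (auto simp: isotropic_def)
  have "par v \<notin> par ` set (subset_sums F)"
    using v(3) by (simp add: hull2_def)
  moreover have "\<forall>f\<in>set F. even (bf f (par v))"
    using orth pv by blast
  ultimately obtain x where x: "x \<in> set (subset_sums F)" "reachable F u (par v + x)"
    using ext v(2) par_in_bits[of v] unfolding extensible_def by meson
  define z where "z = par v + x"
  have z: "z \<in> S"
    using subsetD[OF subset_sums_in_isotropic[OF S] x(1)] pv S(1) by (simp add: z_def isotropic_def)
  have quz: "even (qf u - qf z)"
    using x by (simp add: reachable_def z_def)
  consider "par z = par u" | "odd (bf u z)"
    | w where "odd (bf u w)" "odd (bf w z)" "even (qf u - qf w)" "\<forall>f\<in>set F. even (bf f w)"
    using x(2) unfolding reachable_def z_def[symmetric] by blast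
  then show ?thesis
  proof cases
    case 1
    then show ?thesis
      using that[of S] S isotropic_par_cong[OF S(1) 1] z by simp
  next
    case 2
    obtain T where "move S T" "insert u (set F) \<subseteq> T"
      by (rule move_one[OF S(1) z S(2) Fu orth[OF _ z] 2 quz])
    then show ?thesis
      using that[of T] by auto
  next
    case 3
    \<comment> \<open>The first reflection brings in \<open>w\<close> in place of \<open>z\<close>,
      the second \<open>u\<close> in place of \<open>w\<close>.\<close>
    have "even (qf w - qf z)"
      using 3(3) quz by presburger
    then obtain T where T: "move S T" "insert w (set F) \<subseteq> T"
      using move_one[OF S(1) z S(2) 3(4)[rule_format] orth[OF _ z] 3(2)] by metis
    have "isotropic T"
      using isotropic_moves[OF r_into_rtranclp[of move, OF T(1)] S(1)] .
    moreover have "w \<in> T" "set F \<subseteq> T"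
      using T by auto
    ultimately obtain T' where T': "move T T'" "insert u (set F) \<subseteq> T'"
      by (rule move_one[OF _ _ _ Fu 3(4)[rule_format] 3(1,3)])
    have "move\<^sup>*\<^sup>* S T'"
      using T(1) T'(1) by (meson converse_rtranclp_into_rtranclp r_into_rtranclp)
    then show ?thesis
      by (rule that) (use T' in simp)
  qed
qed

section \<open>Classification of totally isotropic subspaces by standard ones\<close>

text \<open>The simple roots e1, e3, e5 are pairwise orthogonal; e1 + e3 and e1 + e5 span the kernel
  of q on their F_2-span. Oddness is demanded only for the first vector: afterwards adding e1
  corrects the parity.\<close>

lemma extensible_odd1:
  "extensible (\<lambda>v. odd (qf v)) [] (1,0,0,0,0,0)"
  by code_simp

lemma extensible_odd2:
  "extensible (\<lambda>v. True) [(1,0,0,0,0,0)] (0,0,1,0,0,0)"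
  by code_simp

lemma extensible_odd3:
  "extensible (\<lambda>v. True) [(0,0,1,0,0,0), (1,0,0,0,0,0)] (0,0,0,0,1,0)"
  by code_simp

lemma extensible_even1:
  "extensible (\<lambda>v. even (qf v)) [] (1,0,1,0,0,0)"
  by code_simp

lemma extensible_even2:
  "extensible (\<lambda>v. even (qf v)) [(1,0,1,0,0,0)] (1,0,0,0,1,0)"
  by code_simp

text \<open>As E6 has odd determinant 3, \<open>bf\<close> is nondegenerate modulo 2, so a
  3-dimensional totally isotropic subspace is its own orthogonal complement.\<close>

lemma maximal_odd:
  "\<forall>v\<in>set bits. (\<forall>f\<in>set [(0,0,0,0,1,0), (0,0,1,0,0,0), (1,0,0,0,0,0)]. even (bf f v)) \<longrightarrow>
    v \<in> par ` set (subset_sums [(0,0,0,0,1,0), (0,0,1,0,0,0), (1,0,0,0,0,0)])"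
  by code_simp

text \<open>The form q on E6/2E6 has Witt index 2, so a totally singular plane is maximal.\<close>

lemma maximal_even:
  "\<forall>v\<in>set bits. even (qf v) \<and> (\<forall>f\<in>set [(1,0,0,0,1,0), (1,0,1,0,0,0)]. even (bf f v)) \<longrightarrow>
    v \<in> par ` set (subset_sums [(1,0,0,0,1,0), (1,0,1,0,0,0)])"
  by code_simp

lemma isotropic_classification:
  assumes S: "isotropic S"
  obtains T F where "move\<^sup>*\<^sup>* S T" "set F \<subseteq> T" "T \<subseteq> hull2 F"
    "F \<in> {[], [(1,0,0,0,0,0)], [(0,0,1,0,0,0), (1,0,0,0,0,0)],
      [(0,0,0,0,1,0), (0,0,1,0,0,0), (1,0,0,0,0,0)],
      [(1,0,1,0,0,0)], [(1,0,0,0,1,0), (1,0,1,0,0,0)]}"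
proof -
  let ?a = "(1,0,0,0,0,0) :: vec" and ?b = "(0,0,1,0,0,0) :: vec" and ?c = "(0,0,0,0,1,0) :: vec"
  let ?d = "(1,0,1,0,0,0) :: vec" and ?e = "(1,0,0,0,1,0) :: vec"
  define good where "good T F \<longleftrightarrow> move\<^sup>*\<^sup>* S T \<and> set F \<subseteq> T" for T and F :: "vec list"
  have par: "par v \<in> T" if "good T F" "v \<in> T" for T F v
    using isotropic_par_cong[OF isotropic_moves[OF _ S], of T "par v" v] that by (simp add: good_def)
  have orth: "even (bf f v)" if "good T F" "f \<in> set F" "v \<in> T" for T F f v
    using isotropic_moves[OF _ S, of T] that by (auto simp: good_def isotropic_def)
  have ext: "\<exists>T'. good T' (u # F)"
    if T: "good T F" and extensible: "extensible A F u" and "\<not> T \<subseteq> hull2 F"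
      and allowed: "\<And>v. v \<in> T \<Longrightarrow> A v" for T F A u
  proof -
    obtain v where v: "v \<in> T" "v \<notin> hull2 F"
      using \<open>\<not> T \<subseteq> hull2 F\<close> by blast
    have "A (par v)"
      using allowed par[OF T v(1)] by blast
    then obtain T' where "move\<^sup>*\<^sup>* T T'" "set (u # F) \<subseteq> T'"
      using extend[of T F A u v] isotropic_moves[OF _ S, of T] T extensible v unfolding good_def by metis
    then show ?thesis
      using T unfolding good_def by (meson rtranclp_trans)
  qed
  have good0: "good S []"
    by (simp add: good_def)
  show ?thesis
  proof (cases "\<forall>v\<in>S. even (qf v)")
    case False
    then obtain v where v: "v \<in> S" "odd (qf v)"
      by blast
    have "v \<notin> hull2 []"
      using v(2) even_qf_cong[of v 0] by (auto simp: hull2_def zero_prod_def)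
    moreover have "odd (qf (par v))"
      using v(2) even_qf_cong[of "par v" v] by simp
    \<comment> \<open>Here \<open>ext\<close> does not apply: it asks for its predicate on the whole
      set, while oddness is known only for \<open>v\<close>.\<close>
    ultimately obtain T1 where T1: "good T1 [?a]"
      using extend[OF S _ extensible_odd1 v(1)] unfolding good_def by auto
    show ?thesis
    proof (cases "T1 \<subseteq> hull2 [?a]")
      case True
      with T1 show ?thesis
        by (intro that[of T1 "[?a]"]) (auto simp: good_def)
    next
      case False
      then obtain T2 where T2: "good T2 [?b, ?a]"
        using ext[OF T1 extensible_odd2] by blast
      show ?thesis
      proof (cases "T2 \<subseteq> hull2 [?b, ?a]")
        case True
        with T2 show ?thesis
          by (intro that[of T2 "[?b, ?a]"]) (auto simp: good_def)
      next
        case False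
        then obtain T3 where T3: "good T3 [?c, ?b, ?a]"
          using ext[OF T2 extensible_odd3] by blast
        have "v \<in> hull2 [?c, ?b, ?a]" if "v \<in> T3" for v
          using maximal_odd par_in_bits[of v] orth[OF T3 _ par[OF T3 that]]
          unfolding hull2_def mem_Collect_eq by blast
        with T3 show ?thesis
          by (intro that[of T3 "[?c, ?b, ?a]"]) (auto simp: good_def)
      qed
    qed
  next
    case True
    have even: "even (qf v)" if "good T F" "v \<in> T" for T F v
      using even_moves[OF _ True] that by (auto simp: good_def)
    show ?thesis
    proof (cases "S \<subseteq> hull2 []")
      case True
      with good0 show ?thesis
        by (intro that[of S "[]"]) (auto simp: good_def)
    next
      case False
      then obtain T1 where T1: "good T1 [?d]"
        using ext[OF good0 extensible_even1 _ even[OF good0]] by blast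
      show ?thesis
      proof (cases "T1 \<subseteq> hull2 [?d]")
        case True
        with T1 show ?thesis
          by (intro that[of T1 "[?d]"]) (auto simp: good_def)
      next
        case False
        then obtain T2 where T2: "good T2 [?e, ?d]"
          using ext[OF T1 extensible_even2 _ even[OF T1]] by blast
        have "v \<in> hull2 [?e, ?d]" if "v \<in> T2" for v
          using maximal_even par_in_bits[of v] orth[OF T2 _ par[OF T2 that]]
            even[OF T2 par[OF T2 that]]
          unfolding hull2_def mem_Collect_eq by blast
        with T2 show ?thesis
          by (intro that[of T2 "[?e, ?d]"]) (auto simp: good_def)
      qed
    qed
  qed
qed

section \<open>Realization of the coordinates in the space of Lambda_6\<close>

locale e6_basis =
  fixes e1 e2 e3 e4 e5 e6 :: "'a::euclidean_space"
  assumes gram: "gram_matrix [e1, e2, e3, e4, e5, e6] = map (map ((*) 2))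
      [[ 2, -1,  0,  0,  0,  0],
       [-1,  2, -1,  0,  0,  0],
       [ 0, -1,  2, -1,  0, -1],
       [ 0,  0, -1,  2, -1,  0],
       [ 0,  0,  0, -1,  2,  0],
       [ 0,  0, -1,  0,  0,  2]]"
begin

lemmas inners = gram[unfolded gram_matrix_def, simplified]

fun emb :: "vec \<Rightarrow> 'a" where
  "emb (a, b, c, d, e, f) = of_int a *\<^sub>R e1 + of_int b *\<^sub>R e2 + of_int c *\<^sub>R e3 +
    of_int d *\<^sub>R e4 + of_int e *\<^sub>R e5 + of_int f *\<^sub>R e6"

definition lattice :: "'a set" where
  "lattice = int_span {e1, e2, e3, e4, e5, e6}"

lemma emb_add: "emb (u + v) = emb u + emb v"
  by (cases u; cases v) (simp add: algebra_simps)

lemma emb_zero: "emb 0 = 0"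
  by (simp add: zero_prod_def)

lemma emb_diff: "emb (u - v) = emb u - emb v"
  using emb_add[of "u - v" v] by (simp add: algebra_simps)

lemma emb_scale: "emb (scale k v) = of_int k *\<^sub>R emb v"
  by (cases v) (simp add: algebra_simps)

lemma inner_emb: "emb u \<bullet> emb v = 2 * of_int (bf u v)"
  by (cases u; cases v) (simp add: bf_def inner_add_left inner_add_right inners algebra_simps)

lemma lattice_eq: "lattice = range emb"
proof
  show "lattice \<subseteq> range emb"
    unfolding lattice_def
  proof (rule int_mod.span_minimal)
    have "e1 = emb (1,0,0,0,0,0)" "e2 = emb (0,1,0,0,0,0)" "e3 = emb (0,0,1,0,0,0)"
      "e4 = emb (0,0,0,1,0,0)" "e5 = emb (0,0,0,0,1,0)" "e6 = emb (0,0,0,0,0,1)"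
      by simp_all
    then show "{e1, e2, e3, e4, e5, e6} \<subseteq> range emb"
      by blast
    show "int_mod.subspace (range emb)"
    proof (rule int_mod.subspaceI)
      show "0 \<in> range emb"
        using rangeI[of emb 0] by (simp only: emb_zero)
    qed (elim rangeE; simp only: rangeI flip: emb_add emb_scale)+
  qed
next
  show "range emb \<subseteq> lattice"
  proof
    fix x assume "x \<in> range emb"
    then obtain v where "x = emb v" by blast
    then show "x \<in> lattice"
      unfolding lattice_def
      by (cases v) (simp add: int_mod.span_add int_mod.span_scale int_mod.span_base)
  qed
qed

text \<open>Identifies E6 with (1/2) Lambda_6, so that doubles in E6 correspond to Lambda_6.\<close>

definition half :: "vec \<Rightarrow> 'a" where
  "half v = (1/2) *\<^sub>R emb v"

lemma half_add: "half (u + v) = half u + half v"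
  by (simp add: half_def emb_add scaleR_add_right)

lemma half_double: "half (v + v) = emb v"
  by (simp add: half_def emb_add flip: scaleR_2)

text \<open>The divisor is 2 because \<open>emb r\<close> has norm 4 for a root
  \<open>r\<close>.\<close>

definition reflection :: "vec \<Rightarrow> 'a \<Rightarrow> 'a" where
  "reflection r x = x - ((x \<bullet> emb r) / 2) *\<^sub>R emb r"

lemma linear_reflection: "linear (reflection r)"
  by (rule linearI)
    (simp_all add: reflection_def inner_add_left add_divide_distrib algebra_simps)

lemma inner_reflection:
  assumes "qf r = 1"
  shows "reflection r x \<bullet> reflection r y = x \<bullet> y"
  using assms
  by (simp add: reflection_def inner_diff_left inner_diff_right inner_emb bf_self
      inner_commute[of "emb r"] algebra_simps)

lemma reflection_half: "reflection r (half v) = half (reflect r v)"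
  by (simp add: reflection_def half_def reflect_def emb_diff emb_scale inner_emb scaleR_diff_right)

text \<open>The reflection carries \<open>half\<close> S\<open>onto\<close>half \<open>T\<close>, so
  an isometry defined on the latter can be composed with it.\<close>

lemma isometric_move:
  assumes "move S T" "isometric (half ` T) L"
  shows "isometric (half ` S) L"
proof -
  obtain r where r: "qf r = 1" "T = reflect r -` S"
    using assms(1) by (auto simp: move_def)
  obtain f where f: "linear f" "\<forall>x\<in>span (half ` T). \<forall>y\<in>span (half ` T). f x \<bullet> f y = x \<bullet> y"
    "f ` half ` T = L"
    using assms(2) unfolding isometric_def by blast
  have "reflect r ` S = T"
  proof (rule set_eqI, rule iffI)
    show "v \<in> T" if "v \<in> reflect r ` S" for v
      using that unfolding r(2) by (metis imageE reflect_reflect[OF r(1)] vimageI)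
    show "v \<in> reflect r ` S" if "v \<in> T" for v
      using that unfolding r(2) by (metis imageI reflect_reflect[OF r(1)] vimageD)
  qed
  then have T: "half ` T = reflection r ` half ` S"
    by (simp only: image_image reflection_half flip: \<open>reflect r ` S = T\<close>)
  then have "span (half ` T) = reflection r ` span (half ` S)"
    by (simp only: linear_span_image linear_reflection)
  then have "\<forall>x\<in>span (half ` S). \<forall>y\<in>span (half ` S).
      (f \<circ> reflection r) x \<bullet> (f \<circ> reflection r) y = x \<bullet> y"
    using f(2) inner_reflection[OF r(1)] by simp
  moreover have "(f \<circ> reflection r) ` half ` S = L"
    using f(3) T by (simp only: image_comp comp_assoc)
  ultimately show ?thesis
    unfolding isometric_def using linear_compose[OF linear_reflection f(1)] by blast
qed

lemma isometric_moves:
  assumes "move\<^sup>*\<^sup>* S T" "isometric (half ` T) L"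
  shows "isometric (half ` S) L"
  using assms by (induction rule: converse_rtranclp_induct) (auto intro: isometric_move)

text \<open>Such an \<open>S\<close> is 2E6 plus the subset sums of \<open>F\<close>; halving turns
  2E6 into Lambda_6 and the sums into sums of the adjoined vectors.\<close>

lemma half_image_eq_adjoin:
  assumes S: "isotropic S" "set F \<subseteq> S" "S \<subseteq> hull2 F"
  shows "half ` S = adjoin lattice (half ` set F)"
proof
  have sub: "half x \<in> adjoin lattice (half ` set F)" if "x \<in> set (subset_sums F)" for x
    using that
  proof (induction F arbitrary: x)
    case Nil
    then show ?case
      by (simp add: adjoin_def half_def int_mod.span_zero emb_zero)
  next
    case (Cons f F)
    have mono: "adjoin lattice (half ` set F) \<subseteq> adjoin lattice (half ` set (f # F))"
      unfolding adjoin_def by (rule int_mod.span_mono) auto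
    have f: "half f \<in> adjoin lattice (half ` set (f # F))"
      unfolding adjoin_def by (rule int_mod.span_base) auto
    consider "x \<in> set (subset_sums F)" | y where "y \<in> set (subset_sums F)" "x = f + y"
      using Cons.prems unfolding subset_sums.simps set_append set_map by blast
    then show ?case
    proof cases
      case 1
      then show ?thesis
        using Cons.IH mono by blast
    next
      case 2
      then have "half y \<in> adjoin lattice (half ` set (f # F))"
        using Cons.IH mono by blast
      then show ?thesis
        using f unfolding 2 half_add adjoin_def by (rule int_mod.span_add[rotated])
    qed
  qed
  show "half ` S \<subseteq> adjoin lattice (half ` set F)"
  proof
    fix y assume "y \<in> half ` S"
    then obtain v where v: "v \<in> S" "y = half v" by blast
    then obtain x where x: "x \<in> set (subset_sums F)" "par v = par x"
      using S(3) by (auto simp: hull2_def)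
    then obtain z where "v = x + (z + z)"
      by (auto simp: par_eq_iff)
    then have "y = half x + emb z"
      using v by (simp add: half_add[of x] half_double)
    moreover have "emb z \<in> adjoin lattice (half ` set F)"
      unfolding adjoin_def by (rule int_mod.span_base) (simp add: lattice_eq)
    ultimately show "y \<in> adjoin lattice (half ` set F)"
      using sub[OF x(1)] by (simp add: adjoin_def int_mod.span_add)
  qed
next
  show "adjoin lattice (half ` set F) \<subseteq> half ` S"
    unfolding adjoin_def
  proof (rule int_mod.span_minimal)
    have "emb v \<in> half ` S" for v
      using S(1) by (auto simp: isotropic_def simp flip: half_double)
    then show "lattice \<union> half ` set F \<subseteq> half ` S"
      using S(2) by (auto simp: lattice_eq)
    have "scale k v \<in> S" if "v \<in> S" for k v
      using S(1) that by (rule isotropic_scale)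
    moreover have "of_int k *\<^sub>R half v = half (scale k v)" for k v
      by (simp add: half_def emb_scale)
    moreover have "0 \<in> S"
      using subset_sums_in_isotropic[OF S(1), of "[]"] by simp
    moreover have "half 0 = 0"
      by (simp add: half_def emb_zero)
    ultimately show "int_mod.subspace (half ` S)"
      using S(1) by (intro int_mod.subspaceI) (force simp: isotropic_def simp flip: half_add)+
  qed
qed


section \<open>Integral overlattices as totally isotropic subspaces\<close>

text \<open>Integral pairings with Lambda_6 leave denominators dividing 6 in the coordinates;
  integrality of the norm removes the factor 3.\<close>

lemma integral_vector_in_half_lattice:
  assumes x: "x \<in> span lattice" and int: "\<And>v. x \<bullet> emb v \<in> \<int>" "x \<bullet> x \<in> \<int>"
  shows "x \<in> range half"
proof -
  have "lattice \<subseteq> span {e1, e2, e3, e4, e5, e6}"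
  proof
    fix y assume "y \<in> lattice"
    then obtain v where "y = emb v"
      unfolding lattice_eq by blast
    then show "y \<in> span {e1, e2, e3, e4, e5, e6}"
      by (cases v) (simp add: span_add span_scale span_base)
  qed
  then have "x \<in> span {e1, e2, e3, e4, e5, e6}"
    using x span_mono[of lattice "span {e1, e2, e3, e4, e5, e6}"] by (auto simp: span_span)
  then obtain c1 c2 c3 c4 c5 c6 where c: "x = c1 *\<^sub>R e1 + c2 *\<^sub>R e2 + c3 *\<^sub>R e3 + c4 *\<^sub>R e4 + c5 *\<^sub>R e5 + c6 *\<^sub>R e6"
    by (auto simp: span_breakdown_eq algebra_simps)
  obtain n1 n2 n3 n4 n5 n6 where n: "x \<bullet> e1 = of_int n1" "x \<bullet> e2 = of_int n2" "x \<bullet> e3 = of_int n3"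
    "x \<bullet> e4 = of_int n4" "x \<bullet> e5 = of_int n5" "x \<bullet> e6 = of_int n6"
    using int(1)[of "(1,0,0,0,0,0)"] int(1)[of "(0,1,0,0,0,0)"] int(1)[of "(0,0,1,0,0,0)"]
      int(1)[of "(0,0,0,1,0,0)"] int(1)[of "(0,0,0,0,1,0)"] int(1)[of "(0,0,0,0,0,1)"]
    by (auto elim!: Ints_cases)
  obtain m where m: "x \<bullet> x = of_int m"
    using int(2) by (auto elim: Ints_cases)
  have eqs: "of_int n1 = 4 * c1 - 2 * c2" "of_int n2 = 4 * c2 - 2 * c1 - 2 * c3"
    "of_int n3 = 4 * c3 - 2 * c2 - 2 * c4 - 2 * c6" "of_int n4 = 4 * c4 - 2 * c3 - 2 * c5"
    "of_int n5 = 4 * c5 - 2 * c4" "of_int n6 = 4 * c6 - 2 * c3"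
    unfolding n[symmetric] c by (simp_all add: inner_add_left inners)
  (* The inverse of the E6 Cartan matrix is (1/3) times an integral matrix that modulo 3 equals
     w w^T for w = (1, 2, 0, 1, 2, 0); l is the pairing with w. *)
  define l where "l = n1 + 2 * n2 + n4 + 2 * n5"
  \<comment> \<open>With C the Cartan matrix, \<open>eqs\<close> says n = 2 C c, so 6 c is 3 C^-1 n.
    Subtracting \<open>l\<close> times w leaves multiples of 3, whose quotients are
    \<open>k1\<close> to \<open>k6\<close>.\<close>
  define k1 where "k1 = n1 + n2 + 2 * n3 + n4 + n6"
  define k2 where "k2 = n1 + 2 * n2 + 4 * n3 + 2 * n4 + 2 * n6"
  define k3 where "k3 = 2 * n1 + 4 * n2 + 6 * n3 + 4 * n4 + 2 * n5 + 3 * n6"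
  define k4 where "k4 = n1 + 2 * n2 + 4 * n3 + 3 * n4 + n5 + 2 * n6"
  define k5 where "k5 = 2 * n3 + n4 + n6"
  define k6 where "k6 = n1 + 2 * n2 + 3 * n3 + 2 * n4 + n5 + 2 * n6"
  have k: "6 * c1 = of_int (l + 3 * k1)" "6 * c2 = of_int (2 * l + 3 * k2)"
    "6 * c3 = of_int (3 * k3)" "6 * c4 = of_int (l + 3 * k4)" "6 * c5 = of_int (2 * l + 3 * k5)"
    "6 * c6 = of_int (3 * k6)"
    unfolding l_def k1_def k2_def k3_def k4_def k5_def k6_def
    by (simp_all add: eqs)
  have "x \<bullet> x = c1 * n1 + c2 * n2 + c3 * n3 + c4 * n4 + c5 * n5 + c6 * n6"
    by (subst (2) c) (simp add: inner_add_right n)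
  then have "6 * of_int m = (6 * c1) * n1 + (6 * c2) * n2 + (6 * c3) * n3 + (6 * c4) * n4 +
      (6 * c5) * n5 + (6 * c6) * n6"
    by (simp add: m algebra_simps)
  then have "real_of_int (6 * m) = of_int ((l + 3 * k1) * n1 + (2 * l + 3 * k2) * n2 + 3 * k3 * n3 +
      (l + 3 * k4) * n4 + (2 * l + 3 * k5) * n5 + 3 * k6 * n6)"
    unfolding k by simp
  then have "6 * m = (l + 3 * k1) * n1 + (2 * l + 3 * k2) * n2 + 3 * k3 * n3 +
      (l + 3 * k4) * n4 + (2 * l + 3 * k5) * n5 + 3 * k6 * n6"
    by (simp only: of_int_eq_iff)
  \<comment> \<open>The terms with factor \<open>l\<close> add up to \<open>l\<close> times the
    pairing of n with w, which is \<open>l\<close> again.\<close>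
  then have "l * l = 3 * (2 * m - (k1 * n1 + k2 * n2 + k3 * n3 + k4 * n4 + k5 * n5 + k6 * n6))"
    by (simp add: l_def algebra_simps)
  then have "(l mod 3) * (l mod 3) mod 3 = 0"
    by (simp add: mod_mult_eq)
  moreover have "l mod 3 = 0 \<or> l mod 3 = 1 \<or> l mod 3 = 2"
    by presburger
  ultimately have "l mod 3 = 0"
    by auto
  then obtain j where j: "l = 3 * j"
    by auto
  have "c1 = (j + k1) / 2" "c2 = (2 * j + k2) / 2" "c3 = k3 / 2" "c4 = (j + k4) / 2"
    "c5 = (2 * j + k5) / 2" "c6 = k6 / 2"
    using k by (simp_all add: j)
  then have "x = half (j + k1, 2 * j + k2, k3, j + k4, 2 * j + k5, k6)"
    unfolding c by (simp only: half_def emb.simps scaleR_add_right scaleR_scaleR) simp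
  then show ?thesis
    by blast
qed

text \<open>The inner product of \<open>half u\<close> and \<open>half v\<close> is
  \<open>bf u v / 2\<close>, so integrality of \<open>M\<close> means evenness of
  \<open>bf\<close>.\<close>

lemma isotropic_half_vimage:
  assumes M: "integral_lattice M" "lattice \<subseteq> M"
  shows "isotropic {v. half v \<in> M}"
proof -
  obtain B where B: "M = int_span B"
    using M by (auto simp: integral_lattice_def is_lattice_def lattice_basis_def)
  have "half (u + v) \<in> M" if "half u \<in> M" "half v \<in> M" for u v
    using that unfolding B half_add by (rule int_mod.span_add)
  moreover have "even (bf u v)" if "half u \<in> M" "half v \<in> M" for u v
  proof -
    have "half u \<bullet> half v = of_int (bf u v) / 2"
      by (simp add: half_def inner_emb)
    moreover have "half u \<bullet> half v \<in> \<int>"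
      using M that by (auto simp: integral_lattice_def)
    ultimately obtain k where "of_int (bf u v) / 2 = real_of_int k"
      by (metis Ints_cases)
    then have "real_of_int (bf u v) = of_int (2 * k)"
      by simp
    then show ?thesis
      by (simp only: of_int_eq_iff) simp
  qed
  moreover have "half (v + v) \<in> M" for v
    using M(2) by (auto simp only: half_double lattice_eq)
  ultimately show ?thesis
    by (simp add: isotropic_def)
qed

lemma overlattice_isometric:
  assumes M: "integral_lattice M" "M \<subseteq> span lattice" "lattice \<subseteq> M"
  obtains F where "F \<in> {[], [(1,0,0,0,0,0)], [(0,0,1,0,0,0), (1,0,0,0,0,0)],
      [(0,0,0,0,1,0), (0,0,1,0,0,0), (1,0,0,0,0,0)],
      [(1,0,1,0,0,0)], [(1,0,0,0,1,0), (1,0,1,0,0,0)]}"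
    "isometric M (adjoin lattice (half ` set F))"
proof -
  define S where "S = {v. half v \<in> M}"
  have S: "isotropic S"
    unfolding S_def using M(1,3) by (rule isotropic_half_vimage)
  have "x \<in> range half" if "x \<in> M" for x
  proof (rule integral_vector_in_half_lattice)
    show "x \<in> span lattice" "x \<bullet> x \<in> \<int>"
      using M that by (auto simp: integral_lattice_def)
    show "x \<bullet> emb v \<in> \<int>" for v
      using M that lattice_eq unfolding integral_lattice_def by blast
  qed
  then have MS: "M = half ` S"
    unfolding S_def by blast
  obtain T F where T: "move\<^sup>*\<^sup>* S T" "set F \<subseteq> T" "T \<subseteq> hull2 F"
    and F: "F \<in> {[], [(1,0,0,0,0,0)], [(0,0,1,0,0,0), (1,0,0,0,0,0)],
      [(0,0,0,0,1,0), (0,0,1,0,0,0), (1,0,0,0,0,0)],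
      [(1,0,1,0,0,0)], [(1,0,0,0,1,0), (1,0,1,0,0,0)]}"
    using isotropic_classification[OF S] .
  \<comment> \<open>The identity serves for \<open>T\<close> and is pulled back along the moves to
    \<open>S\<close>.\<close>
  have "isometric (half ` T) (half ` T)"
    unfolding isometric_def by (intro exI[of _ id]) (auto simp: linear_id)
  then have "isometric M (half ` T)"
    unfolding MS by (rule isometric_moves[OF T(1)])
  then show ?thesis
    using that[OF F] half_image_eq_adjoin[OF isotropic_moves[OF T(1) S] T(2,3)] by simp
qed

end

theorem theorem7p1:
  fixes e1 e2 e3 e4 e5 e6 :: "'a::euclidean_space" and \<Lambda>\<^sub>6 M :: "'a set"
  assumes "lattice_basis [e1, e2, e3, e4, e5, e6] \<Lambda>\<^sub>6"
    and "gram_matrix [e1, e2, e3, e4, e5, e6] = map (map ((*) 2))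
      [[ 2, -1,  0,  0,  0,  0],
       [-1,  2, -1,  0,  0,  0],
       [ 0, -1,  2, -1,  0, -1],
       [ 0,  0, -1,  2, -1,  0],
       [ 0,  0,  0, -1,  2,  0],
       [ 0,  0, -1,  0,  0,  2]]"
    and "integral_lattice M"
    and "M \<subseteq> span \<Lambda>\<^sub>6"
    and "\<Lambda>\<^sub>6 \<subseteq> M"
  shows "\<exists>L \<in> {\<Lambda>\<^sub>6,
      adjoin \<Lambda>\<^sub>6 {(1/2) *\<^sub>R e1},
      adjoin \<Lambda>\<^sub>6 {(1/2) *\<^sub>R (e1 + e3)},
      adjoin \<Lambda>\<^sub>6 {(1/2) *\<^sub>R e1, (1/2) *\<^sub>R e3},
      adjoin \<Lambda>\<^sub>6 {(1/2) *\<^sub>R (e1 + e3), (1/2) *\<^sub>R (e1 + e5)},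
      adjoin \<Lambda>\<^sub>6 {(1/2) *\<^sub>R e1, (1/2) *\<^sub>R e3, (1/2) *\<^sub>R e5}}.
    isometric M L"
proof -
  interpret e6_basis e1 e2 e3 e4 e5 e6
    by unfold_locales (fact assms(2))
  have lat: "lattice = \<Lambda>\<^sub>6"
    using assms(1) by (simp add: lattice_basis_def lattice_def)
  then obtain F where F: "F \<in> {[], [(1,0,0,0,0,0)], [(0,0,1,0,0,0), (1,0,0,0,0,0)],
      [(0,0,0,0,1,0), (0,0,1,0,0,0), (1,0,0,0,0,0)],
      [(1,0,1,0,0,0)], [(1,0,0,0,1,0), (1,0,1,0,0,0)]}"
    and iso: "isometric M (adjoin \<Lambda>\<^sub>6 (half ` set F))"
    using overlattice_isometric[OF assms(3)] assms(4,5) by metis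
  have "adjoin \<Lambda>\<^sub>6 {} = \<Lambda>\<^sub>6"
    by (simp add: adjoin_def lattice_def int_mod.span_span flip: lat)
  then show ?thesis
    \<comment> \<open>The lists hold the latest vector first, whence
      \<open>insert_commute\<close>.\<close>
    using F iso by (auto simp: half_def insert_commute)
qed

end
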